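(* Let $P$ be an $N\times N$ stochastic matrix. Then $P$ is embeddable if and only if it is nonsingular and in the closure of the set $$\{ P \, : \, P=(1-\epsilon)^{m} (I-\epsilon H)^{-m},\ 0 \leq \epsilon < 1,\ m \in \mathbb{N},\ H \text{ an } N\times N \text{ stochastic matrix} \}.$$
   Context: A stochastic matrix is a real square matrix with nonnegative entries whose rows each sum to $1$. An intensity matrix is a real square matrix with nonnegative off-diagonal entries whose rows each sum to $0$. A stochastic matrix $P$ is embeddable if there exists an intensity matrix $R$ with $P=e^{R}$ (matrix exponential). $I$ is the $N\times N$ identity matrix. Closure is taken in the usual topology (any matrix norm) on $N\times N$ real matrices. *)

theory Defs
  imports "HOL-Analysis.Analysis"
begin

definition stochastic_matrix :: "real ^ 'n ^ 'n \<Rightarrow> bool" where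
  "stochastic_matrix P \<longleftrightarrow> (\<forall>i j. 0 \<le> P $ i $ j) \<and> (\<forall>i. (\<Sum>j\<in>UNIV. P $ i $ j) = 1)"

definition intensity_matrix :: "real ^ 'n ^ 'n \<Rightarrow> bool" where
  "intensity_matrix R \<longleftrightarrow>
     (\<forall>i j. i \<noteq> j \<longrightarrow> 0 \<le> R $ i $ j) \<and> (\<forall>i. (\<Sum>j\<in>UNIV. R $ i $ j) = 0)"

text \<open>
  The library operations \<open>^\<close> and \<open>*\<close> on type \<^typ>\<open>real ^ 'n ^ 'n\<close> act entrywise (and \<open>exp\<close>
  is not available there), so powers and the exponential with respect to the
  matrix product \<open>**\<close> are defined here.
\<close>

primrec matrix_power :: "real ^ 'n ^ 'n \<Rightarrow> nat \<Rightarrow> real ^ 'n ^ 'n" where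
  "matrix_power A 0 = mat 1"
| "matrix_power A (Suc k) = A ** matrix_power A k"

definition matrix_exp :: "real ^ 'n ^ 'n \<Rightarrow> real ^ 'n ^ 'n" where
  "matrix_exp A = (\<Sum>k. matrix_power A k /\<^sub>R fact k)"

definition embeddable :: "real ^ 'n ^ 'n \<Rightarrow> bool" where
  "embeddable P \<longleftrightarrow> (\<exists>R. intensity_matrix R \<and> P = matrix_exp R)"

text \<open>
  The next two lemmas show that the totalised constants \<open>suminf\<close> and \<open>matrix_inv\<close> are only used
  where they have their usual meaning.
\<close>

lemma matrix_exp_sums:
  fixes A :: "real ^ 'n ^ 'n"
  shows "(\<lambda>k. matrix_power A k /\<^sub>R fact k) sums matrix_exp A"
proof -
  have "bilinear ((**) :: real ^ 'n ^ 'n \<Rightarrow> real ^ 'n ^ 'n \<Rightarrow> real ^ 'n ^ 'n)"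
    by (auto simp: bilinear_def matrix_add_ldistrib matrix_matrix_mult_def vec_eq_iff
        sum.distrib algebra_simps sum_distrib_left intro!: linearI)
  then have "bounded_bilinear ((**) :: real ^ 'n ^ 'n \<Rightarrow> real ^ 'n ^ 'n \<Rightarrow> real ^ 'n ^ 'n)"
    by (simp add: bilinear_conv_bounded_bilinear)
  from bounded_bilinear.nonneg_bounded[OF this]
  obtain K where K: "K \<ge> 0"
    "\<And>(X :: real ^ 'n ^ 'n) (Y :: real ^ 'n ^ 'n). norm (X ** Y) \<le> norm X * norm Y * K"
    by auto
  let ?c = "norm (mat 1 :: real ^ 'n ^ 'n)" and ?q = "norm A * K"
  have pow: "norm (matrix_power A k) \<le> ?c * ?q ^ k" for k
  proof (induction k)
    case (Suc k)
    have "norm (matrix_power A (Suc k)) \<le> ?q * norm (matrix_power A k)"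
      using K(2)[of A "matrix_power A k"] by (simp add: mult_ac)
    also have "\<dots> \<le> ?q * (?c * ?q ^ k)"
      using Suc K(1) by (intro mult_left_mono) auto
    finally show ?case by (simp add: mult_ac)
  qed simp
  have "summable (\<lambda>k. ?c * (?q ^ k /\<^sub>R fact k))"
    by (intro summable_mult summable_exp_generic)
  moreover have "norm (matrix_power A k /\<^sub>R fact k) \<le> ?c * (?q ^ k /\<^sub>R fact k)" for k
    using pow[of k] by (simp add: field_simps)
  ultimately have "summable (\<lambda>k. matrix_power A k /\<^sub>R fact k)"
    by (rule summable_comparison_test'[where N = 0])
  then show ?thesis
    unfolding matrix_exp_def by (rule summable_sums)
qed

lemma invertible_resolvent:
  fixes H :: "real ^ 'n ^ 'n"
  assumes H: "stochastic_matrix H" and e: "0 \<le> \<epsilon>" "\<epsilon> < 1"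
  shows "invertible (mat 1 - \<epsilon> *\<^sub>R H)"
proof -
  have "x = 0" if "(mat 1 - \<epsilon> *\<^sub>R H) *v x = 0" for x
  proof -
    have x: "x $ i = \<epsilon> * (\<Sum>j\<in>UNIV. H $ i $ j * x $ j)" for i
    proof -
      have "(\<epsilon> *\<^sub>R H) *v x = \<epsilon> *\<^sub>R (H *v x)"
        by (simp add: vec_eq_iff matrix_vector_mult_def sum_distrib_left mult.assoc)
      then have "x = \<epsilon> *\<^sub>R (H *v x)"
        using that by (simp add: matrix_vector_mult_diff_rdistrib)
      then have "x $ i = (\<epsilon> *\<^sub>R (H *v x)) $ i" by (rule arg_cong)
      then show ?thesis
        by (simp add: matrix_vector_mult_def)
    qed
    define M where "M = Max (range (\<lambda>i. \<bar>x $ i\<bar>))"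
    have le: "\<bar>x $ i\<bar> \<le> M" for i unfolding M_def by simp
    have "M \<in> range (\<lambda>i. \<bar>x $ i\<bar>)" unfolding M_def by (rule Max_in) auto
    then obtain i where i: "M = \<bar>x $ i\<bar>" by auto
    have "\<bar>\<Sum>j\<in>UNIV. H $ i $ j * x $ j\<bar> \<le> (\<Sum>j\<in>UNIV. \<bar>H $ i $ j * x $ j\<bar>)"
      by (rule sum_abs)
    also have "\<dots> \<le> (\<Sum>j\<in>UNIV. H $ i $ j * M)"
      using H le by (intro sum_mono) (auto simp: stochastic_matrix_def abs_mult intro!: mult_mono)
    also have "\<dots> = M"
      using H by (simp add: stochastic_matrix_def flip: sum_distrib_right)
    finally have "\<bar>\<Sum>j\<in>UNIV. H $ i $ j * x $ j\<bar> \<le> M" .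
    then have "M \<le> \<epsilon> * M"
      using e x[of i] i by (metis abs_mult abs_of_nonneg mult_left_mono)
    then have "(1 - \<epsilon>) * M \<le> 0" by (simp add: algebra_simps)
    then have "M \<le> 0" using e by (simp add: mult_le_0_iff)
    then show ?thesis using le by (simp add: vec_eq_iff) (meson abs_le_zero_iff order_trans)
  qed
  then show ?thesis
    by (simp add: invertible_left_inverse matrix_left_invertible_ker)
qed

end

theory Submission
  imports Defs
begin

text \<open>
  Write \<open>A = (1 - \<epsilon>) (I - \<epsilon> H)\<^sup>-\<^sup>1\<close> with \<open>H\<close> stochastic and \<open>0 \<le> \<epsilon> < 1\<close>. The logarithmic series
  converges at \<open>\<epsilon> H\<close> and gives \<open>A = e\<^sup>G\<close> with \<open>G = (\<Sum>n\<ge>1. (\<epsilon>\<^sup>n / n) (H\<^sup>n - I))\<close>. As all powers of \<open>H\<close>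
  are stochastic, \<open>G\<close> is an intensity matrix (\<open>intensity_resolvent_generator\<close>), so every matrix
  \<open>A\<^sup>m = e\<^bsup>m G\<^esup>\<close> is embeddable (\<open>exp_resolvent_generator\<close>). Both directions follow from this.

  If \<open>P\<close> is nonsingular and a limit of such matrices \<open>e\<^sup>R\<close>, then \<open>det e\<^sup>R = e\<^bsup>tr R\<^esup>\<close> (\<open>det_exp\<close>) stays away
  from \<open>0\<close>, so \<open>tr R\<close> is bounded below. The trace of an intensity matrix bounds all its entries, so
  the matrices \<open>R\<close> range over a compact set (\<open>compact_intensity_trace_ge\<close>). The image of this set
  under the exponential is compact, hence closed, and so contains \<open>P\<close>.

  Conversely let \<open>P = e\<^sup>R\<close>. It is nonsingular since \<open>det P = e\<^bsup>tr R\<^esup>\<close>. Write \<open>R = \<mu> (H - I)\<close> with \<open>H\<close>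
  stochastic and \<open>\<mu> > 0\<close>, and let \<open>\<epsilon> = \<mu> / m\<close>. Since \<open>G = \<epsilon> (H - I) + O(\<epsilon>\<^sup>2)\<close>, the exponents \<open>m G\<close> tend
  to \<open>R\<close> (\<open>resolvent_generator_rescaled_tendsto\<close>), and continuity of the exponential gives
  \<open>A\<^sup>m \<longlonglongrightarrow> P\<close>.

  The analysis of the exponential and the logarithm takes place in an arbitrary Banach algebra and
  is transferred to matrices through the type \<open>sqmat\<close>.
\<close>

section \<open>The exponential in a Banach algebra\<close>

lemma continuous_exp_algebra:
  "continuous_on UNIV (exp :: 'a :: {real_normed_algebra_1, banach} \<Rightarrow> 'a)"
proof -
  have "continuous_on (ball 0 r) (exp :: 'a \<Rightarrow> 'a)" for r :: real
  proof (rule uniform_limit_theorem)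
    show "uniform_limit (ball 0 r) (\<lambda>n x. \<Sum>k<n. x ^ k /\<^sub>R fact k) (exp :: 'a \<Rightarrow> 'a) sequentially"
      unfolding exp_def
    proof (rule Weierstrass_m_test)
      fix k and x :: 'a
      assume "x \<in> ball 0 r"
      then show "norm (x ^ k /\<^sub>R fact k) \<le> r ^ k /\<^sub>R fact k"
        by (auto simp: divide_inverse_commute
            intro!: mult_left_mono order_trans[OF norm_power_ineq] power_mono)
    qed (rule summable_exp_generic)
    show "\<forall>\<^sub>F n in sequentially. continuous_on (ball 0 r) (\<lambda>x::'a. \<Sum>k<n. x ^ k /\<^sub>R fact k)"
      by (intro always_eventually allI continuous_intros)
  qed simp
  then have "isCont exp x" for x :: 'a
    by (meson centre_in_ball continuous_on_eq_continuous_at open_ball mem_ball_0 linordered_field_no_ub)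
  then show ?thesis
    by (simp add: continuous_at_imp_continuous_on)
qed

text \<open>
  The series of \<open>exp x - 1 - x\<close> starts with \<open>x\<^sup>2\<close>, and the remaining factors are dominated by
  those of \<open>exp (norm x)\<close>. This quadratic bound is what makes \<open>exp\<close> differentiable at \<open>0\<close>.
\<close>

lemma norm_exp_minus_one_minus_self_le:
  fixes x :: "'a :: {real_normed_algebra_1, banach}"
  shows "norm (exp x - 1 - x) \<le> (norm x)\<^sup>2 * exp (norm x)"
proof -
  have "(\<lambda>n. x ^ (n + 2) /\<^sub>R fact (n + 2)) sums (exp x - (\<Sum>n<2. x ^ n /\<^sub>R fact n))"
    by (rule sums_split_initial_segment[OF exp_converges])
  then have eq: "exp x - 1 - x = (\<Sum>n. x ^ (n + 2) /\<^sub>R fact (n + 2))"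
    by (simp add: sums_iff numeral_2_eq_2 diff_diff_eq)
  have majorant: "(\<lambda>n. (norm x)\<^sup>2 * (norm x ^ n /\<^sub>R fact n)) sums ((norm x)\<^sup>2 * exp (norm x))"
    by (intro sums_mult exp_converges)
  have "norm (x ^ (n + 2) /\<^sub>R fact (n + 2)) \<le> (norm x)\<^sup>2 * (norm x ^ n /\<^sub>R fact n)" for n
  proof -
    have "norm (x ^ (n + 2) /\<^sub>R fact (n + 2)) = inverse (fact (n + 2)) * norm (x ^ (n + 2))"
      by simp
    also have "\<dots> \<le> inverse (fact n) * norm x ^ (n + 2)"
      by (intro mult_mono norm_power_ineq le_imp_inverse_le fact_mono) auto
    also have "\<dots> = (norm x)\<^sup>2 * (norm x ^ n /\<^sub>R fact n)"
      unfolding power_add by simp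
    finally show ?thesis .
  qed
  then show ?thesis
    unfolding eq sums_unique[OF majorant]
    by (rule norm_suminf_le[OF _ sums_summable[OF majorant]])
qed

lemma exp_has_derivative_at_0:
  "((exp :: 'a \<Rightarrow> 'a :: {real_normed_algebra_1, banach}) has_derivative (\<lambda>h. h)) (at 0)"
proof (rule has_derivativeI_sandwich[where e = 1 and H = "\<lambda>y. norm y * exp (norm y)"])
  show "((\<lambda>y::'a. norm y * exp (norm y)) \<longlongrightarrow> 0) (at 0)"
    by (auto intro!: tendsto_eq_intros)
  fix y :: 'a
  assume "y \<noteq> 0"
  then show "norm (exp y - exp 0 - (y - 0)) / norm (y - 0) \<le> norm y * exp (norm y)"
    using norm_exp_minus_one_minus_self_le[of y] by (simp add: field_simps power2_eq_square)
qed auto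

text \<open>
  In a noncommutative algebra the chain rule for \<open>exp \<circ> F\<close> fails in general. Along a commuting
  family, however, \<open>exp (F s) = exp (F t) * exp (F s - F t)\<close>, so only the derivative of \<open>exp\<close> at \<open>0\<close>
  enters.
\<close>

lemma exp_commuting_has_vector_derivative:
  fixes F :: "real \<Rightarrow> 'a :: {real_normed_algebra_1, banach}"
  assumes F: "(F has_vector_derivative D) (at t)"
    and S: "open S" "t \<in> S"
    and comm: "\<And>s. s \<in> S \<Longrightarrow> F s * F t = F t * F s"
  shows "((\<lambda>s. exp (F s)) has_vector_derivative exp (F t) * D) (at t)"
proof -
  have shift: "((\<lambda>s. F s - F t) has_derivative (\<lambda>h. h *\<^sub>R D)) (at t)"
    using F by (auto simp: has_vector_derivative_def intro!: derivative_eq_intros)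
  have "((\<lambda>s. exp (F s - F t)) has_derivative (\<lambda>h. h *\<^sub>R D)) (at t)"
    using has_derivative_compose[OF shift, of exp "\<lambda>h. h"] exp_has_derivative_at_0 by simp
  then have "((\<lambda>s. exp (F t) * exp (F s - F t)) has_derivative (\<lambda>h. exp (F t) * (h *\<^sub>R D))) (at t)"
    by (intro has_derivative_mult_right)
  moreover have "exp (F t) * exp (F s - F t) = exp (F s)" if "s \<in> S" for s
    using exp_add_commuting[of "F t" "F s - F t"] comm[OF that] by (simp add: algebra_simps)
  ultimately have "((\<lambda>s. exp (F s)) has_derivative (\<lambda>h. exp (F t) * (h *\<^sub>R D))) (at t)"
    by (rule has_derivative_transform_within_open[OF _ S])
  then show ?thesis
    by (simp add: has_vector_derivative_def)
qed

lemma exp_of_nat_scaleR: "exp (real m *\<^sub>R x) = exp x ^ m"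
  for x :: "'a :: {real_normed_algebra_1, banach}"
proof (induction m)
  case (Suc m)
  have "exp (real (Suc m) *\<^sub>R x) = exp (x + real m *\<^sub>R x)"
    by (simp add: scaleR_add_left)
  also have "\<dots> = exp x * exp x ^ m"
    using Suc by (subst exp_add_commuting) simp_all
  finally show ?case by simp
qed simp

section \<open>The logarithm in a Banach algebra\<close>

text \<open>
  The series of \<open>- log (1 - t x)\<close>. It is a function of a real parameter \<open>t\<close>, since its
  identification as a logarithm rests on differentiating in \<open>t\<close>.
\<close>

definition log_series :: "'a :: {real_normed_algebra_1, banach} \<Rightarrow> real \<Rightarrow> 'a" where
  "log_series x t = (\<Sum>n. (t ^ Suc n / Suc n) *\<^sub>R x ^ Suc n)"

context
  fixes x :: "'a :: {real_normed_algebra_1, banach}"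
  assumes x: "norm x \<le> 1"
begin

lemma norm_power_le_one: "norm (x ^ n) \<le> 1"
  using norm_power_ineq[of x n] power_le_one[OF norm_ge_zero x, of n] by linarith

lemma summable_geometric_algebra:
  assumes "\<bar>t\<bar> < 1"
  shows "summable (\<lambda>n. t ^ n *\<^sub>R x ^ n)"
proof (rule summable_comparison_test')
  show "summable (\<lambda>n. \<bar>t\<bar> ^ n)"
    using assms by (intro summable_geometric) simp
  show "norm (t ^ n *\<^sub>R x ^ n) \<le> \<bar>t\<bar> ^ n" for n
    using norm_power_le_one[of n] by (simp add: power_abs mult_left_le)
qed

lemma geometric_algebra:
  assumes "\<bar>t\<bar> < 1"
  shows "(\<Sum>n. t ^ n *\<^sub>R x ^ n) * (1 - t *\<^sub>R x) = 1"
proof -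
  let ?S = "\<Sum>n. t ^ n *\<^sub>R x ^ n"
  note sm = summable_geometric_algebra[OF assms]
  have "?S * (t *\<^sub>R x) = (\<Sum>n. t ^ n *\<^sub>R x ^ n * (t *\<^sub>R x))"
    by (rule suminf_mult2[OF sm])
  also have "\<dots> = (\<Sum>n. t ^ Suc n *\<^sub>R x ^ Suc n)"
    by (simp add: power_commutes mult.commute)
  also have "\<dots> = ?S - 1"
    using suminf_split_head[OF sm] by simp
  finally show ?thesis
    by (simp add: right_diff_distrib)
qed

text \<open>
  Termwise differentiation yields \<open>x (1 - t x)\<^sup>-\<^sup>1\<close>, where the inverse appears as its geometric
  series.
\<close>

lemma
  assumes "\<bar>t\<bar> < 1"
  shows log_series_sums: "(\<lambda>n. (t ^ Suc n / Suc n) *\<^sub>R x ^ Suc n) sums log_series x t"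
    and log_series_has_vector_derivative: "(log_series x has_vector_derivative (x * (\<Sum>n. t ^ n *\<^sub>R x ^ n))) (at t)"
proof -
  \<comment> \<open>For parameters below \<open>r\<close> in absolute value, the differentiated series has the geometric majorant \<open>r ^ n\<close>.\<close>
  define r where "r = (\<bar>t\<bar> + 1) / 2"
  have r: "\<bar>t\<bar> < r" "r < 1" "0 < r"
    using assms by (auto simp: r_def)
  define f where "f = (\<lambda>n t. (t ^ Suc n / Suc n) *\<^sub>R x ^ Suc n)"
  define d where "d = (\<lambda>n t. t ^ n *\<^sub>R x ^ Suc n)"
  have u: "uniform_limit {-r<..<r} (\<lambda>n t. \<Sum>i<n. d i t) (\<lambda>t. \<Sum>n. d n t) sequentially"
  proof (rule Weierstrass_m_test)
    show "summable (\<lambda>n. r ^ n)"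
      using r by (intro summable_geometric) simp
    fix n s
    assume "s \<in> {-r<..<r}"
    then have "norm (d n s) \<le> r ^ n * 1"
      unfolding d_def norm_scaleR
      by (intro mult_mono norm_power_le_one) (auto simp: power_abs intro!: power_mono)
    then show "norm (d n s) \<le> r ^ n" by simp
  qed
  have "\<exists>g. \<forall>s\<in>{-r<..<r}. (\<lambda>n. f n s) sums g s \<and>
      (g has_derivative (\<lambda>h. h *\<^sub>R (\<Sum>n. d n s))) (at s within {-r<..<r})"
  proof (rule has_derivative_series[where x = 0 and l = 0])
    show "(f n has_derivative (\<lambda>h. h *\<^sub>R d n s)) (at s within {-r<..<r})" for n s
    proof -
      have "((\<lambda>t. t ^ Suc n / Suc n) has_real_derivative s ^ n) (at s within {-r<..<r})"
        by (auto intro!: derivative_eq_intros simp del: power_Suc)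
      then show ?thesis
        unfolding f_def d_def has_field_derivative_def
        by (rule has_derivative_eq_rhs[OF has_derivative_scaleR_left]) (simp add: mult.commute)
    qed
    fix e :: real
    assume "e > 0"
    with u have "\<forall>\<^sub>F n in sequentially. \<forall>s\<in>{-r<..<r}. norm ((\<Sum>i<n. d i s) - (\<Sum>n. d n s)) < e"
      by (auto simp: uniform_limit_iff dist_norm)
    then show "\<forall>\<^sub>F n in sequentially. \<forall>s\<in>{-r<..<r}. \<forall>h.
        norm ((\<Sum>i<n. h *\<^sub>R d i s) - h *\<^sub>R (\<Sum>n. d n s)) \<le> e * norm h"
    proof eventually_elim
      case (elim n)
      have "norm ((\<Sum>i<n. h *\<^sub>R d i s) - h *\<^sub>R (\<Sum>n. d n s)) \<le> e * norm h"
        if "s \<in> {-r<..<r}" for s h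
      proof -
        have "norm ((\<Sum>i<n. h *\<^sub>R d i s) - h *\<^sub>R (\<Sum>n. d n s))
            = norm h * norm ((\<Sum>i<n. d i s) - (\<Sum>n. d n s))"
          by (simp flip: scaleR_sum_right scaleR_diff_right)
        also have "\<dots> \<le> norm h * e"
          using elim that by (intro mult_left_mono) (auto intro: less_imp_le)
        finally show ?thesis
          by (simp add: mult.commute)
      qed
      then show ?case by blast
    qed
  qed (use r in \<open>auto simp: f_def\<close>)
  then obtain g where g: "\<And>s. s \<in> {-r<..<r} \<Longrightarrow> (\<lambda>n. f n s) sums g s"
    "\<And>s. s \<in> {-r<..<r} \<Longrightarrow> (g has_derivative (\<lambda>h. h *\<^sub>R (\<Sum>n. d n s))) (at s within {-r<..<r})"
    by blast
  have t: "t \<in> {-r<..<r}" using r by auto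
  have L: "log_series x s = g s" if "s \<in> {-r<..<r}" for s
    using sums_unique[OF g(1)[OF that]] by (simp add: log_series_def f_def)
  show "(\<lambda>n. (t ^ Suc n / Suc n) *\<^sub>R x ^ Suc n) sums log_series x t"
    using g(1)[OF t] L[OF t] by (simp add: f_def)
  have "(g has_derivative (\<lambda>h. h *\<^sub>R (\<Sum>n. d n t))) (at t)"
    using g(2)[OF t] t by (metis at_within_open open_greaterThanLessThan)
  then have "(log_series x has_derivative (\<lambda>h. h *\<^sub>R (\<Sum>n. d n t))) (at t)"
    by (rule has_derivative_transform_within_open[OF _ open_greaterThanLessThan t]) (simp add: L)
  moreover have "(\<Sum>n. d n t) = x * (\<Sum>n. t ^ n *\<^sub>R x ^ n)"
    unfolding d_def using suminf_mult[OF summable_geometric_algebra[OF assms], of x] by simp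
  ultimately show "(log_series x has_vector_derivative (x * (\<Sum>n. t ^ n *\<^sub>R x ^ n))) (at t)"
    by (simp add: has_vector_derivative_def)
qed

end

text \<open>
  What commutes with \<open>x\<close> commutes with its powers, hence with a series in them. This supplies the
  commutation needed to differentiate \<open>exp (log_series x t)\<close> in \<open>t\<close> and to add exponents.
\<close>

lemma log_series_commute:
  fixes x y :: "'a :: {real_normed_algebra_1, banach}"
  assumes x: "norm x \<le> 1" and s: "\<bar>s\<bar> < 1" and xy: "y * x = x * y"
  shows "y * log_series x s = log_series x s * y"
proof -
  have "(\<lambda>n. y * ((s ^ Suc n / Suc n) *\<^sub>R x ^ Suc n)) sums (y * log_series x s)"
    by (intro sums_mult log_series_sums x s)
  moreover have "(\<lambda>n. ((s ^ Suc n / Suc n) *\<^sub>R x ^ Suc n) * y) sums (log_series x s * y)"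
    by (intro sums_mult2 log_series_sums x s)
  moreover have "y * x ^ Suc n = x ^ Suc n * y" for n
    using power_commuting_commutes[of x y "Suc n"] xy by metis
  ultimately show ?thesis
    by (simp add: sums_iff del: power_Suc)
qed

text \<open>
  The product on the left is \<open>1\<close> at \<open>t = 0\<close> and its derivative in \<open>t\<close> vanishes, because the
  derivative \<open>x (1 - t x)\<^sup>-\<^sup>1\<close> of the logarithm cancels against that of \<open>1 - t x\<close>.
\<close>

lemma exp_log_series:
  fixes x :: "'a :: {real_normed_algebra_1, banach}"
  assumes x: "norm x \<le> 1" and t: "\<bar>t\<bar> < 1"
  shows "exp (log_series x t) * (1 - t *\<^sub>R x) = 1"
proof -
  define G where "G = (\<lambda>s. exp (log_series x s) * (1 - s *\<^sub>R x))"
  have "(G has_vector_derivative 0) (at s)" if s: "\<bar>s\<bar> < 1" for s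
  proof -
    let ?S = "\<Sum>n. s ^ n *\<^sub>R x ^ n"
    have "((\<lambda>u. exp (log_series x u)) has_vector_derivative exp (log_series x s) * (x * ?S)) (at s)"
    proof (rule exp_commuting_has_vector_derivative[OF log_series_has_vector_derivative[OF x s]])
      show "open {-1<..<1::real}" "s \<in> {-1<..<1}"
        using s by auto
      show "log_series x u * log_series x s = log_series x s * log_series x u" if "u \<in> {-1<..<1}" for u
        using that s x by (intro log_series_commute log_series_commute[symmetric]) auto
    qed
    moreover have "((\<lambda>u. 1 - u *\<^sub>R x) has_vector_derivative - x) (at s)"
      by (auto intro!: derivative_eq_intros)
    ultimately have "(G has_vector_derivative exp (log_series x s) * - x
        + exp (log_series x s) * (x * ?S) * (1 - s *\<^sub>R x)) (at s)"
      unfolding G_def by (rule has_vector_derivative_mult)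
    then show ?thesis
      using geometric_algebra[OF x s] by (simp add: mult.assoc)
  qed
  then have "(G has_vector_derivative 0) (at s within {-1<..<1})" if "s \<in> {-1<..<1}" for s
    using that by (auto intro: has_vector_derivative_at_within)
  then obtain c where c: "\<And>s. s \<in> {-1<..<1} \<Longrightarrow> G s = c"
    using has_vector_derivative_zero_constant[of "{-1<..<1::real}" G] by auto
  have "G t = G 0" using c[of t] c[of 0] t by (simp add: abs_less_iff)
  also have "G 0 = 1" by (simp add: G_def log_series_def)
  finally show ?thesis by (simp add: G_def)
qed

section \<open>Square matrices as a Banach algebra\<close>

text \<open>
  On \<open>real ^ 'n ^ 'n\<close> the class operations are entrywise, so a copy of this type carries the matrix
  product. Its norm is the largest absolute row sum, that is, the operator norm for the maximum
  norm on vectors: for this norm every stochastic matrix has norm exactly \<open>1\<close>, which puts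
  \<open>\<epsilon> H\<close> with \<open>\<epsilon> < 1\<close> inside the disc of convergence of the logarithm.
\<close>

typedef ('n::finite) sqmat = "UNIV :: (real ^ 'n ^ 'n) set"
  morphisms of_sqmat Sqmat ..

lemmas [simp] = Sqmat_inverse[OF UNIV_I] of_sqmat_inverse

lemma sqmat_eq_iff: "A = B \<longleftrightarrow> (\<forall>i j. of_sqmat A $ i $ j = of_sqmat B $ i $ j)"
  by (metis of_sqmat_inject vec_eq_iff)

instantiation sqmat :: (finite) real_normed_algebra_1
begin

definition "(0 :: 'a sqmat) = Sqmat 0"
definition "(1 :: 'a sqmat) = Sqmat (mat 1)"
definition "(A :: 'a sqmat) + B = Sqmat (of_sqmat A + of_sqmat B)"
definition "(A :: 'a sqmat) - B = Sqmat (of_sqmat A - of_sqmat B)"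
definition "- (A :: 'a sqmat) = Sqmat (- of_sqmat A)"
definition "(A :: 'a sqmat) * B = Sqmat (of_sqmat A ** of_sqmat B)"
definition "c *\<^sub>R (A :: 'a sqmat) = Sqmat (c *\<^sub>R of_sqmat A)"
definition "norm (A :: 'a sqmat) = (MAX i. \<Sum>j\<in>UNIV. \<bar>of_sqmat A $ i $ j\<bar>)"
definition "dist (A :: 'a sqmat) B = norm (A - B)"
definition "sgn (A :: 'a sqmat) = inverse (norm A) *\<^sub>R A"
definition "uniformity = (INF e\<in>{0<..}. principal {(A, B :: 'a sqmat). dist A B < e})"
definition "open (U :: 'a sqmat set) =
  (\<forall>x\<in>U. eventually (\<lambda>(x', y). x' = x \<longrightarrow> y \<in> U) uniformity)"

lemmas sqmat_op_defs = zero_sqmat_def one_sqmat_def plus_sqmat_def minus_sqmat_def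
  uminus_sqmat_def times_sqmat_def scaleR_sqmat_def

lemma row_sum_le_norm: "(\<Sum>j\<in>UNIV. \<bar>of_sqmat A $ i $ j\<bar>) \<le> norm A"
  unfolding norm_sqmat_def by (rule Max_ge) auto

lemma norm_sqmat_leI: "(\<And>i. (\<Sum>j\<in>UNIV. \<bar>of_sqmat A $ i $ j\<bar>) \<le> c) \<Longrightarrow> norm A \<le> c"
  unfolding norm_sqmat_def by (subst Max_le_iff) auto

lemma norm_sqmat_nonneg: "0 \<le> norm (A :: 'a sqmat)"
  by (rule order_trans[OF _ row_sum_le_norm[of A undefined]]) (simp add: sum_nonneg)

lemma entry_le_norm: "\<bar>of_sqmat A $ i $ j\<bar> \<le> norm A"
  by (rule order_trans[OF _ row_sum_le_norm[of A i]]) (rule member_le_sum; simp)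

instance
proof
  fix A B C :: "'a sqmat" and c d :: real
  show "A + B + C = A + (B + C)" "A + B = B + A" "0 + A = A" "- A + A = 0" "A - B = A + - B"
    by (simp_all add: sqmat_op_defs add_ac)
  show "c *\<^sub>R (A + B) = c *\<^sub>R A + c *\<^sub>R B" "(c + d) *\<^sub>R A = c *\<^sub>R A + d *\<^sub>R A"
    "c *\<^sub>R d *\<^sub>R A = (c * d) *\<^sub>R A" "1 *\<^sub>R A = A"
    by (simp_all add: sqmat_op_defs algebra_simps)
  show "A * B * C = A * (B * C)"
    by (simp add: sqmat_op_defs matrix_mul_assoc)
  show "1 * A = A" "A * 1 = A"
    by (simp_all add: sqmat_op_defs)
  show "(A + B) * C = A * C + B * C" "A * (B + C) = A * B + A * C"
    by (simp_all add: sqmat_eq_iff sqmat_op_defs matrix_matrix_mult_def sum.distrib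
        distrib_left distrib_right)
  show "c *\<^sub>R A * B = c *\<^sub>R (A * B)" "A * c *\<^sub>R B = c *\<^sub>R (A * B)"
    by (simp_all add: sqmat_eq_iff sqmat_op_defs matrix_matrix_mult_def sum_distrib_left mult_ac)
  show "(0 :: 'a sqmat) \<noteq> 1"
    by (auto simp: sqmat_eq_iff sqmat_op_defs mat_def)
  show "dist A B = norm (A - B)" "sgn A = inverse (norm A) *\<^sub>R A"
    by (fact dist_sqmat_def sgn_sqmat_def)+
  show "uniformity = (INF e\<in>{0<..}. principal {(A, B :: 'a sqmat). dist A B < e})"
    by (fact uniformity_sqmat_def)
  show "open U \<longleftrightarrow> (\<forall>x\<in>U. eventually (\<lambda>(x', y). x' = x \<longrightarrow> y \<in> U) uniformity)"
    for U :: "'a sqmat set"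
    by (fact open_sqmat_def)
  show "norm A = 0 \<longleftrightarrow> A = 0"
  proof
    assume "norm A = 0"
    then show "A = 0"
      using entry_le_norm[of A] by (simp add: sqmat_eq_iff sqmat_op_defs)
  next
    assume "A = 0"
    then show "norm A = 0"
      by (simp add: norm_sqmat_def sqmat_op_defs image_constant_conv)
  qed
  show "norm (A + B) \<le> norm A + norm B"
  proof (rule norm_sqmat_leI)
    fix i
    have "(\<Sum>j\<in>UNIV. \<bar>of_sqmat (A + B) $ i $ j\<bar>)
        \<le> (\<Sum>j\<in>UNIV. \<bar>of_sqmat A $ i $ j\<bar>) + (\<Sum>j\<in>UNIV. \<bar>of_sqmat B $ i $ j\<bar>)"
      unfolding sum.distrib[symmetric] by (intro sum_mono) (simp add: sqmat_op_defs abs_triangle_ineq)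
    then show "(\<Sum>j\<in>UNIV. \<bar>of_sqmat (A + B) $ i $ j\<bar>) \<le> norm A + norm B"
      using row_sum_le_norm[of A i] row_sum_le_norm[of B i] by linarith
  qed
  have scale: "norm (c *\<^sub>R A) \<le> \<bar>c\<bar> * norm A" for c and A :: "'a sqmat"
    by (rule norm_sqmat_leI)
      (simp add: sqmat_op_defs abs_mult sum_distrib_left[symmetric] mult_left_mono row_sum_le_norm)
  show "norm (c *\<^sub>R A) = \<bar>c\<bar> * norm A"
  proof (cases "c = 0")
    case True
    then show ?thesis
      using scale[of c A] norm_sqmat_nonneg[of "c *\<^sub>R A"] by simp
  next
    case False
    then have "norm A \<le> \<bar>inverse c\<bar> * norm (c *\<^sub>R A)"
      using scale[of "inverse c" "c *\<^sub>R A"] by (simp add: sqmat_op_defs)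
    then show ?thesis
      using False scale[of c A] by (simp add: field_simps)
  qed
  show "norm (A * B) \<le> norm A * norm B"
  proof (rule norm_sqmat_leI)
    fix i
    have "(\<Sum>j\<in>UNIV. \<bar>of_sqmat (A * B) $ i $ j\<bar>)
        \<le> (\<Sum>j\<in>UNIV. \<Sum>k\<in>UNIV. \<bar>of_sqmat A $ i $ k\<bar> * \<bar>of_sqmat B $ k $ j\<bar>)"
      by (intro sum_mono)
        (simp add: sqmat_op_defs matrix_matrix_mult_def abs_mult[symmetric] sum_abs)
    also have "\<dots> = (\<Sum>k\<in>UNIV. \<bar>of_sqmat A $ i $ k\<bar> * (\<Sum>j\<in>UNIV. \<bar>of_sqmat B $ k $ j\<bar>))"
      by (subst sum.swap) (simp add: sum_distrib_left)
    also have "\<dots> \<le> (\<Sum>k\<in>UNIV. \<bar>of_sqmat A $ i $ k\<bar> * norm B)"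
      by (intro sum_mono mult_left_mono row_sum_le_norm) simp
    also have "\<dots> \<le> norm A * norm B"
      unfolding sum_distrib_right[symmetric]
      by (intro mult_right_mono row_sum_le_norm norm_sqmat_nonneg)
    finally show "(\<Sum>j\<in>UNIV. \<bar>of_sqmat (A * B) $ i $ j\<bar>) \<le> norm A * norm B" .
  qed
  have "(\<Sum>j\<in>UNIV. \<bar>of_sqmat (1 :: 'a sqmat) $ i $ j\<bar>) = 1" for i
    by (simp add: sqmat_op_defs mat_def if_distrib cong: if_cong)
  then show "norm (1 :: 'a sqmat) = 1"
    by (simp add: norm_sqmat_def)
qed

end

lemma bounded_linear_Sqmat: "bounded_linear (Sqmat :: real ^ 'n ^ 'n \<Rightarrow> 'n sqmat)"
  by (intro linear_conv_bounded_linear[THEN iffD1] linearI) (simp_all add: sqmat_op_defs)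

lemma bounded_linear_of_sqmat: "bounded_linear (of_sqmat :: 'n::finite sqmat \<Rightarrow> real ^ 'n ^ 'n)"
proof (rule bounded_linear_intro)
  fix A :: "'n sqmat"
  have "norm (of_sqmat A) \<le> (\<Sum>i\<in>UNIV. norm (of_sqmat A $ i))"
    unfolding norm_vec_def by (rule L2_set_le_sum) simp
  also have "\<dots> \<le> (\<Sum>i\<in>(UNIV :: 'n set). norm A)"
    by (intro sum_mono order_trans[OF norm_le_l1_cart row_sum_le_norm])
  finally show "norm (of_sqmat A) \<le> norm A * CARD('n)"
    by (simp add: mult.commute)
qed (simp_all add: sqmat_op_defs)

text \<open>
  Completeness is inherited from \<open>real ^ 'n ^ 'n\<close> because both coercions are bounded.
\<close>

instance sqmat :: (finite) banach
proof
  fix X :: "nat \<Rightarrow> 'a sqmat"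
  assume "Cauchy X"
  then have "Cauchy (\<lambda>n. of_sqmat (X n))"
    by (rule bounded_linear.Cauchy[OF bounded_linear_of_sqmat])
  then obtain L where "(\<lambda>n. of_sqmat (X n)) \<longlonglongrightarrow> L"
    using Cauchy_convergent convergent_def by blast
  from bounded_linear.tendsto[OF bounded_linear_Sqmat this] show "convergent X"
    by (auto simp: convergent_def)
qed

lemma of_sqmat_power: "of_sqmat (A ^ k) = matrix_power (of_sqmat A) k"
  by (induction k) (simp_all add: sqmat_op_defs)

lemma matrix_exp_eq: "matrix_exp M = of_sqmat (exp (Sqmat M))"
proof -
  have "(\<lambda>k. of_sqmat (Sqmat M ^ k /\<^sub>R fact k)) sums of_sqmat (exp (Sqmat M))"
    by (rule bounded_linear.sums[OF bounded_linear_of_sqmat exp_converges])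
  then have "(\<lambda>k. matrix_power M k /\<^sub>R fact k) sums of_sqmat (exp (Sqmat M))"
    by (simp add: of_sqmat_power linear_simps(5)[OF bounded_linear_of_sqmat])
  then show ?thesis
    using matrix_exp_sums sums_unique2 by blast
qed

lemma continuous_matrix_exp: "continuous_on UNIV (matrix_exp :: real ^ 'n ^ 'n \<Rightarrow> real ^ 'n ^ 'n)"
  unfolding matrix_exp_eq
  by (intro bounded_linear.continuous_on[OF bounded_linear_of_sqmat]
      continuous_on_compose2[OF continuous_exp_algebra]
      bounded_linear.continuous_on[OF bounded_linear_Sqmat] continuous_intros) auto

section \<open>The determinant of an exponential\<close>

text \<open>
  In the Leibniz formula a permutation other than the identity moves at least two indices. Its
  product therefore has at least two factors that vanish at the identity matrix, and contributes
  nothing to the first derivative.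
\<close>

lemma det_has_derivative_at_identity:
  fixes M :: "real \<Rightarrow> real ^ 'n ^ 'n"
  assumes M: "\<And>i j. ((\<lambda>t. M t $ i $ j) has_real_derivative D $ i $ j) (at t)" and M0: "M t = mat 1"
  shows "((\<lambda>t. det (M t)) has_real_derivative trace D) (at t)"
proof -
  have perm: "((\<lambda>t. \<Prod>i\<in>UNIV. M t $ i $ p i) has_real_derivative (if p = id then trace D else 0)) (at t)"
    if p: "p permutes (UNIV :: 'n set)" for p
  proof -
    have "((\<lambda>t. \<Prod>i\<in>UNIV. M t $ i $ p i) has_real_derivative
        (\<Sum>i\<in>UNIV. D $ i $ p i * (\<Prod>j\<in>UNIV - {i}. M t $ j $ p j))) (at t)"
      by (rule has_field_derivative_prod) (rule M)
    moreover have "(\<Sum>i\<in>UNIV. D $ i $ p i * (\<Prod>j\<in>UNIV - {i}. M t $ j $ p j))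
        = (if p = id then trace D else 0)"
    proof (cases "p = id")
      case True
      then show ?thesis by (simp add: M0 mat_def trace_def)
    next
      case False
      have "(\<Prod>j\<in>UNIV - {i}. M t $ j $ p j) = 0" for i
      proof -
        obtain k where k: "p k \<noteq> k" using False by (auto simp: fun_eq_iff)
        then have "p (p k) \<noteq> p k" using permutes_inj[OF p] by (auto dest: injD)
        with k obtain j where "j \<noteq> i" "p j \<noteq> j" by metis
        then have "j \<in> UNIV - {i}" "M t $ j $ p j = 0"
          by (auto simp: M0 mat_def)
        then show ?thesis
          by (intro prod_zero) auto
      qed
      then show ?thesis using False by (simp only: mult_zero_right sum.neutral_const if_False)
    qed
    ultimately show ?thesis by simp
  qed
  have "((\<lambda>t. det (M t)) has_real_derivative
      (\<Sum>p\<in>{p. p permutes (UNIV :: 'n set)}. of_int (sign p) * (if p = id then trace D else 0))) (at t)"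
    unfolding det_def by (intro DERIV_sum DERIV_cmult perm) simp
  moreover have "(\<Sum>p\<in>{p. p permutes (UNIV :: 'n set)}. of_int (sign p) * (if p = id then trace D else 0))
      = trace D"
    by (subst sum.mono_neutral_right[where S = "{id}"]) (auto simp: permutes_id)
  ultimately show ?thesis by simp
qed

text \<open>
  Along the one-parameter group \<open>t \<mapsto> exp (t A)\<close> the determinant is multiplicative, so its
  derivative at \<open>0\<close> determines it through the equation \<open>f' = f \<cdot> tr A\<close>.
\<close>

lemma det_exp: "det (of_sqmat (exp A)) = exp (trace (of_sqmat A))"
  for A :: "'n::finite sqmat"
proof -
  define f where "f = (\<lambda>t::real. det (of_sqmat (exp (t *\<^sub>R A))))"
  let ?c = "trace (of_sqmat A)"
  have split: "f s = f t * f (s - t)" for s t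
  proof -
    have "exp (t *\<^sub>R A) * exp ((s - t) *\<^sub>R A) = exp (s *\<^sub>R A)"
      by (subst exp_add_commuting[symmetric]) (simp_all flip: scaleR_add_left)
    then have "of_sqmat (exp (s *\<^sub>R A)) = of_sqmat (exp (t *\<^sub>R A)) ** of_sqmat (exp ((s - t) *\<^sub>R A))"
      by (metis Sqmat_inverse UNIV_I times_sqmat_def)
    then show ?thesis
      by (simp add: f_def det_mul)
  qed
  have f0: "f 0 = 1" by (simp add: f_def one_sqmat_def)
  have "((\<lambda>t. of_sqmat (exp (t *\<^sub>R A)) $ i $ j) has_real_derivative of_sqmat A $ i $ j) (at 0)" for i j
  proof -
    have "bounded_linear (\<lambda>B. of_sqmat B $ i $ j)"
      by (intro bounded_linear_compose[OF bounded_linear_vec_nth]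
          bounded_linear_compose[OF bounded_linear_vec_nth[of i]] bounded_linear_of_sqmat)
    from bounded_linear.has_vector_derivative[OF this exp_scaleR_has_vector_derivative_left[of A 0]]
    show ?thesis
      by (simp add: has_real_derivative_iff_has_vector_derivative)
  qed
  then have "(f has_real_derivative ?c) (at 0)"
    unfolding f_def by (rule det_has_derivative_at_identity) (simp add: one_sqmat_def)
  then have "((\<lambda>s. f (s - t)) has_real_derivative ?c) (at t)" for t
    using DERIV_shift[of f ?c t "- t"] by simp
  then have "((\<lambda>s. f t * f (s - t)) has_real_derivative f t * ?c) (at t)" for t
    by (rule DERIV_cmult)
  then have f': "(f has_real_derivative f t * ?c) (at t)" for t
    by (simp only: split[symmetric])
  have "((\<lambda>t. f t * exp (- (t * ?c))) has_real_derivative 0) (at t)" for t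
    by (rule derivative_eq_intros f' refl | simp)+
  then have "f 1 * exp (- (1 * ?c)) = f 0 * exp (- (0 * ?c))"
    by (intro DERIV_isconst_all allI)
  then have "f 1 = exp ?c"
    by (simp add: f0 exp_minus field_simps)
  then show ?thesis
    by (simp add: f_def)
qed

lemma det_matrix_exp: "det (matrix_exp R) = exp (trace R)"
  by (simp add: matrix_exp_eq det_exp)

section \<open>Stochastic and intensity matrices\<close>

lemma intensity_sum:
  "(\<And>n. n \<in> S \<Longrightarrow> intensity_matrix (f n)) \<Longrightarrow> intensity_matrix (sum f S)"
  by (subst intensity_matrix_def)
    (auto simp: intensity_matrix_def sum_component sum.swap[of _ S UNIV] intro!: sum_nonneg)

lemma intensity_scaleR: "0 \<le> c \<Longrightarrow> intensity_matrix R \<Longrightarrow> intensity_matrix (c *\<^sub>R R)"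
  by (auto simp: intensity_matrix_def simp flip: sum_distrib_left)

lemma closed_intensity: "closed {R :: real ^ 'n ^ 'n. intensity_matrix R}"
  unfolding intensity_matrix_def
  by (intro closed_Collect_conj closed_Collect_all closed_Collect_imp open_Collect_const
      closed_Collect_le closed_Collect_eq continuous_intros)

lemma intensity_diag: "intensity_matrix R \<Longrightarrow> R $ i $ i = - (\<Sum>j\<in>UNIV - {i}. R $ i $ j)"
  by (simp add: intensity_matrix_def sum.remove[of UNIV i] eq_neg_iff_add_eq_0)

text \<open>
  The diagonal of an intensity matrix is nonpositive and balances the nonnegative rest of each row,
  so the trace alone controls the size of the matrix.
\<close>

lemma intensity_entry_le:
  assumes "intensity_matrix R"
  shows "\<bar>R $ i $ j\<bar> \<le> - trace R"
proof -
  have off: "0 \<le> R $ k $ j" if "j \<in> UNIV - {k}" for k j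
    using assms that by (metis DiffD2 intensity_matrix_def singletonI)
  have diag: "R $ k $ k \<le> 0" for k
    unfolding intensity_diag[OF assms, of k] neg_le_0_iff_le by (rule sum_nonneg) (rule off)
  have "- R $ i $ i \<le> (\<Sum>k\<in>UNIV. - R $ k $ k)"
    by (rule member_le_sum) (use diag in auto)
  then have *: "- R $ i $ i \<le> - trace R"
    by (simp add: trace_def sum_negf)
  show ?thesis
  proof (cases "i = j")
    case True
    then show ?thesis using * diag[of i] by simp
  next
    case False
    then have "R $ i $ j \<le> (\<Sum>k\<in>UNIV - {i}. R $ i $ k)"
      using assms by (intro member_le_sum) (auto simp: intensity_matrix_def)
    then show ?thesis
      using * False assms by (auto simp: intensity_diag[OF assms, of i] intensity_matrix_def)
  qed
qed

text \<open>
  The compactness behind the implication from the closure to embeddability: a lower bound on the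
  determinant of \<open>matrix_exp R\<close> is a lower bound on the trace of \<open>R\<close>.
\<close>

lemma compact_intensity_trace_ge: "compact {R :: real ^ 'n ^ 'n. intensity_matrix R \<and> c \<le> trace R}"
proof -
  have "norm R \<le> (\<Sum>i\<in>(UNIV :: 'n set). \<Sum>j\<in>(UNIV :: 'n set). - c)"
    if "intensity_matrix R" "c \<le> trace R" for R :: "real ^ 'n ^ 'n"
  proof -
    have "norm R \<le> (\<Sum>i\<in>UNIV. norm (R $ i))"
      unfolding norm_vec_def[of R] by (rule L2_set_le_sum) simp
    also have "\<dots> \<le> (\<Sum>i\<in>UNIV. \<Sum>j\<in>UNIV. \<bar>R $ i $ j\<bar>)"
      by (intro sum_mono norm_le_l1_cart)
    also have "\<dots> \<le> (\<Sum>i\<in>(UNIV :: 'n set). \<Sum>j\<in>(UNIV :: 'n set). - c)"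
      by (intro sum_mono order_trans[OF intensity_entry_le]) (use that in auto)
    finally show ?thesis .
  qed
  then have "bounded {R :: real ^ 'n ^ 'n. intensity_matrix R \<and> c \<le> trace R}"
    by (auto simp: bounded_iff)
  moreover have "closed {R :: real ^ 'n ^ 'n. intensity_matrix R \<and> c \<le> trace R}"
    unfolding trace_def
    by (intro closed_Collect_conj closed_intensity closed_Collect_le continuous_intros)
  ultimately show ?thesis
    by (simp add: compact_eq_bounded_closed)
qed

lemma stochastic_matrix_power: "stochastic_matrix H \<Longrightarrow> stochastic_matrix (matrix_power H n)"
proof (induction n)
  case 0
  then show ?case by (simp add: stochastic_matrix_def mat_def)
next
  case (Suc n)
  then have H: "stochastic_matrix H" "stochastic_matrix (matrix_power H n)" by auto
  have "(\<Sum>j\<in>UNIV. \<Sum>k\<in>UNIV. H $ i $ k * matrix_power H n $ k $ j) = 1" for i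
    using H by (subst sum.swap) (simp add: stochastic_matrix_def flip: sum_distrib_left)
  then show ?case
    using H by (auto simp: stochastic_matrix_def matrix_matrix_mult_def intro!: sum_nonneg)
qed

lemma intensity_of_stochastic: "stochastic_matrix H \<Longrightarrow> intensity_matrix (H - mat 1)"
  by (auto simp: intensity_matrix_def stochastic_matrix_def sum_subtractf mat_def)

lemma norm_stochastic: "stochastic_matrix H \<Longrightarrow> norm (Sqmat H) = 1"
  by (simp add: norm_sqmat_def stochastic_matrix_def)

section \<open>Logarithms of normalised resolvents\<close>

text \<open>
  The logarithm of \<open>(1 - \<epsilon>) (1 - \<epsilon> H)\<^sup>-\<^sup>1\<close>; the second series accounts for the scalar factor
  \<open>1 - \<epsilon>\<close>.
\<close>

definition resolvent_generator :: "real ^ 'n ^ 'n \<Rightarrow> real \<Rightarrow> 'n sqmat" where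
  "resolvent_generator H \<epsilon> = log_series (Sqmat H) \<epsilon> - log_series 1 \<epsilon>"

text \<open>
  Merging the two logarithmic series termwise gives \<open>(\<Sum>n\<ge>1. (\<epsilon> ^ n / n) (H ^ n - 1))\<close>. Every
  \<open>H ^ n\<close> is stochastic, so each term is an intensity matrix, and such matrices form a closed cone.
\<close>

lemma intensity_resolvent_generator:
  assumes H: "stochastic_matrix H" and e: "0 \<le> \<epsilon>" "\<epsilon> < 1"
  shows "intensity_matrix (of_sqmat (resolvent_generator H \<epsilon>))"
proof -
  let ?f = "\<lambda>n. (\<epsilon> ^ Suc n / Suc n) *\<^sub>R (matrix_power H (Suc n) - mat 1)"
  have "(\<lambda>n. (\<epsilon> ^ Suc n / Suc n) *\<^sub>R Sqmat H ^ Suc n - (\<epsilon> ^ Suc n / Suc n) *\<^sub>R 1 ^ Suc n)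
      sums resolvent_generator H \<epsilon>"
    unfolding resolvent_generator_def
    by (intro sums_diff log_series_sums) (use e norm_stochastic[OF H] in auto)
  from bounded_linear.sums[OF bounded_linear_of_sqmat this]
  have "(\<lambda>n. of_sqmat ((\<epsilon> ^ Suc n / Suc n) *\<^sub>R Sqmat H ^ Suc n - (\<epsilon> ^ Suc n / Suc n) *\<^sub>R 1 ^ Suc n))
      sums of_sqmat (resolvent_generator H \<epsilon>)" .
  moreover have "of_sqmat ((\<epsilon> ^ Suc n / Suc n) *\<^sub>R Sqmat H ^ Suc n - (\<epsilon> ^ Suc n / Suc n) *\<^sub>R 1 ^ Suc n) = ?f n" for n
    unfolding power_one by (simp only: linear_simps(2,5)[OF bounded_linear_of_sqmat] of_sqmat_power
        scaleR_diff_right Sqmat_inverse[OF UNIV_I] one_sqmat_def)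
  ultimately have "?f sums of_sqmat (resolvent_generator H \<epsilon>)"
    by (simp only:)
  then have "(\<lambda>n. \<Sum>k<n. ?f k) \<longlonglongrightarrow> of_sqmat (resolvent_generator H \<epsilon>)"
    by (simp add: sums_def)
  moreover have "intensity_matrix (\<Sum>k<n. ?f k)" for n
    by (intro intensity_sum intensity_scaleR intensity_of_stochastic stochastic_matrix_power H)
      (use e in auto)
  ultimately show ?thesis
    using closed_sequentially[OF closed_intensity, of "\<lambda>n. \<Sum>k<n. ?f k"] by simp
qed

text \<open>
  Hence each matrix in the set whose closure is considered is embeddable, with an explicit
  generator.
\<close>

lemma exp_resolvent_generator:
  assumes H: "stochastic_matrix (H :: real ^ 'n ^ 'n)" and e: "0 \<le> \<epsilon>" "\<epsilon> < 1"
  shows "matrix_exp (real m *\<^sub>R of_sqmat (resolvent_generator H \<epsilon>))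
    = (1 - \<epsilon>) ^ m *\<^sub>R matrix_power (matrix_inv (mat 1 - \<epsilon> *\<^sub>R H)) m"
proof -
  let ?L = "log_series (Sqmat H) \<epsilon>" and ?E = "log_series (1 :: 'n sqmat) \<epsilon>"
  let ?J = "Sqmat (matrix_inv (mat 1 - \<epsilon> *\<^sub>R H))"
  have inv: "(1 - \<epsilon> *\<^sub>R Sqmat H) * ?J = 1"
    using someI_ex[OF invertible_resolvent[OF H e, unfolded invertible_def]]
    by (simp add: sqmat_op_defs matrix_inv_def)
  have "exp ?L * (1 - \<epsilon> *\<^sub>R Sqmat H) = 1"
    using e norm_stochastic[OF H] by (intro exp_log_series) auto
  then have "exp ?L * ((1 - \<epsilon> *\<^sub>R Sqmat H) * ?J) = ?J"
    by (simp only: mult.assoc[symmetric] mult_1_left)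
  then have L: "exp ?L = ?J"
    by (simp only: inv mult_1_right)
  have "exp ?E * (1 - \<epsilon> *\<^sub>R 1) = 1"
    using e by (intro exp_log_series) auto
  then have "(exp (- ?E) * exp ?E) * (1 - \<epsilon> *\<^sub>R 1) = exp (- ?E)"
    by (simp only: mult.assoc mult_1_right)
  moreover have "exp (- ?E) * exp ?E = 1"
    using exp_add_commuting[of "- ?E" ?E] by simp
  ultimately have E: "exp (- ?E) = (1 - \<epsilon>) *\<^sub>R 1"
    by (simp add: scaleR_left_diff_distrib)
  have "?L * ?E = ?E * ?L"
    using e by (intro log_series_commute) auto
  then have "exp (resolvent_generator H \<epsilon>) = (1 - \<epsilon>) *\<^sub>R ?J"
    unfolding resolvent_generator_def using exp_add_commuting[of ?L "- ?E"] L E by simp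
  then have "exp (real m *\<^sub>R resolvent_generator H \<epsilon>) = (1 - \<epsilon>) ^ m *\<^sub>R ?J ^ m"
    by (simp add: exp_of_nat_scaleR)
  moreover have "Sqmat (real m *\<^sub>R of_sqmat (resolvent_generator H \<epsilon>))
      = real m *\<^sub>R resolvent_generator H \<epsilon>"
    by (simp add: scaleR_sqmat_def)
  ultimately have "matrix_exp (real m *\<^sub>R of_sqmat (resolvent_generator H \<epsilon>))
      = of_sqmat ((1 - \<epsilon>) ^ m *\<^sub>R ?J ^ m)"
    by (simp only: matrix_exp_eq)
  then show ?thesis
    by (simp add: scaleR_sqmat_def of_sqmat_power)
qed

text \<open>
  The derivative of \<open>resolvent_generator H\<close> at \<open>0\<close> is \<open>H - 1\<close>, and \<open>n\<close> times the generator at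
  \<open>\<epsilon> = \<mu> / n\<close> is \<open>\<mu>\<close> times its difference quotient there.
\<close>

lemma resolvent_generator_rescaled_tendsto:
  assumes H: "stochastic_matrix H" and l: "0 < \<mu>"
  shows "(\<lambda>n. real n *\<^sub>R of_sqmat (resolvent_generator H (\<mu> / n))) \<longlonglongrightarrow> \<mu> *\<^sub>R (H - mat 1)"
proof -
  have deriv0: "(log_series x has_vector_derivative x) (at 0)" if "norm x \<le> 1" for x :: "'a sqmat"
    using log_series_has_vector_derivative[OF that, of 0] geometric_algebra[OF that, of 0] by simp
  have "(resolvent_generator H has_vector_derivative (Sqmat H - 1)) (at 0)"
    unfolding resolvent_generator_def
    by (intro has_vector_derivative_diff deriv0) (simp_all add: norm_stochastic[OF H])
  then have "(\<lambda>t. norm (resolvent_generator H t - t *\<^sub>R (Sqmat H - 1)) / norm t) \<midarrow>0\<rightarrow> 0"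
    by (simp add: has_vector_derivative_def has_derivative_at resolvent_generator_def log_series_def)
  then have "((\<lambda>t. norm (resolvent_generator H t /\<^sub>R t - (Sqmat H - 1))) \<longlongrightarrow> 0) (at 0)"
  proof (rule Lim_transform_eventually)
    show "\<forall>\<^sub>F t in at 0. norm (resolvent_generator H t - t *\<^sub>R (Sqmat H - 1)) / norm t
        = norm (resolvent_generator H t /\<^sub>R t - (Sqmat H - 1))"
      unfolding eventually_at_filter
    proof (intro always_eventually allI impI)
      fix t :: real
      assume "t \<noteq> 0"
      then have "resolvent_generator H t /\<^sub>R t - (Sqmat H - 1)
          = (resolvent_generator H t - t *\<^sub>R (Sqmat H - 1)) /\<^sub>R t"
        by (simp add: scaleR_diff_right)
      then show "norm (resolvent_generator H t - t *\<^sub>R (Sqmat H - 1)) / norm t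
          = norm (resolvent_generator H t /\<^sub>R t - (Sqmat H - 1))"
        by (simp add: divide_inverse_commute)
    qed
  qed
  then have "((\<lambda>t. resolvent_generator H t /\<^sub>R t) \<longlongrightarrow> Sqmat H - 1) (at 0)"
    by (simp add: tendsto_norm_zero_iff Lim_null[of _ "Sqmat H - 1"])
  moreover have "filterlim (\<lambda>n. \<mu> / real n) (at 0) sequentially"
    using l eventually_gt_at_top[of 0]
    by (auto simp: filterlim_at lim_const_over_n elim!: eventually_mono)
  ultimately have "(\<lambda>n. resolvent_generator H (\<mu> / n) /\<^sub>R (\<mu> / n)) \<longlonglongrightarrow> Sqmat H - 1"
    by (rule filterlim_compose)
  then have "(\<lambda>n. \<mu> *\<^sub>R of_sqmat (resolvent_generator H (\<mu> / n) /\<^sub>R (\<mu> / n)))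
      \<longlonglongrightarrow> \<mu> *\<^sub>R of_sqmat (Sqmat H - 1)"
    by (intro tendsto_intros bounded_linear.tendsto[OF bounded_linear_of_sqmat])
  then show ?thesis
    using l by (simp add: linear_simps(2,5)[OF bounded_linear_of_sqmat] one_sqmat_def)
qed

section \<open>Embeddable matrices as limits of resolvent powers\<close>

theorem corollary3:
  fixes P :: "real ^ 'n ^ 'n"
  assumes "stochastic_matrix P"
  shows "embeddable P \<longleftrightarrow>
    invertible P \<and>
    P \<in> closure {Q. \<exists>\<epsilon> m H. Q = (1 - \<epsilon>) ^ m *\<^sub>R matrix_power (matrix_inv (mat 1 - \<epsilon> *\<^sub>R H)) m \<and>
                       0 \<le> \<epsilon> \<and> \<epsilon> < 1 \<and> stochastic_matrix (H :: real ^ 'n ^ 'n)}"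
    (is "_ \<longleftrightarrow> _ \<and> P \<in> closure ?T")
proof (intro iffI conjI; (elim conjE)?)
  assume "embeddable P"
  then obtain R where R: "intensity_matrix R" "P = matrix_exp R"
    by (auto simp: embeddable_def)
  show "invertible P"
    by (simp add: R(2) invertible_det_nz det_matrix_exp)
  \<comment> \<open>\<open>H\<close> is nonnegative because \<open>\<mu>\<close> exceeds every diagonal entry of \<open>- R\<close>; the
    summand \<open>1\<close> keeps \<open>\<mu> > 0\<close> for \<open>R = 0\<close>.\<close>
  define \<mu> where "\<mu> = 1 - trace R"
  define H where "H = mat 1 + R /\<^sub>R \<mu>"
  have entry: "\<bar>R $ i $ j\<bar> < \<mu>" for i j
    using intensity_entry_le[OF R(1), of i j] by (simp add: \<mu>_def)
  then have l: "0 < \<mu>"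
    by (meson abs_ge_zero le_less_trans)
  have "0 \<le> H $ i $ j" for i j
    using R(1) entry[of i i] l by (auto simp: H_def mat_def intensity_matrix_def field_simps)
  moreover have "(\<Sum>j\<in>UNIV. H $ i $ j) = 1" for i
    using R(1) by (simp add: H_def mat_def intensity_matrix_def sum.distrib flip: sum_distrib_left)
  ultimately have H: "stochastic_matrix H"
    by (simp add: stochastic_matrix_def)
  have "(\<lambda>n. real n *\<^sub>R of_sqmat (resolvent_generator H (\<mu> / n))) \<longlonglongrightarrow> R"
    using resolvent_generator_rescaled_tendsto[OF H l] l by (simp add: H_def)
  from continuous_on_tendsto_compose[OF continuous_matrix_exp this]
  have "(\<lambda>n. matrix_exp (real n *\<^sub>R of_sqmat (resolvent_generator H (\<mu> / n)))) \<longlonglongrightarrow> P"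
    by (simp add: R(2))
  moreover have "\<forall>\<^sub>F n in sequentially.
      matrix_exp (real n *\<^sub>R of_sqmat (resolvent_generator H (\<mu> / n))) \<in> closure ?T"
    using eventually_gt_at_top[of "nat \<lceil>\<mu>\<rceil>"]
  proof eventually_elim
    case (elim n)
    then have "\<mu> < n" by linarith
    then have "0 \<le> \<mu> / n" "\<mu> / n < 1" using l by auto
    then show ?case
      using exp_resolvent_generator[OF H] H by (intro closure_subset[THEN subsetD]) blast
  qed
  ultimately show "P \<in> closure ?T"
    by (intro Lim_in_closed_set[OF closed_closure _ sequentially_bot])
next
  assume P: "invertible P" "P \<in> closure ?T"
  \<comment> \<open>A positive bound strictly below \<open>\<bar>det P\<bar>\<close>, so that it holds on a neighbourhood of \<open>P\<close>.\<close>
  define \<delta> where "\<delta> = \<bar>det P\<bar> / 2"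
  have d: "0 < \<delta>" "\<delta> < \<bar>det P\<bar>"
    using P(1) by (auto simp: \<delta>_def invertible_det_nz)
  let ?U = "{Q :: real ^ 'n ^ 'n. \<delta> < \<bar>det Q\<bar>}"
  let ?K = "{R :: real ^ 'n ^ 'n. intensity_matrix R \<and> ln \<delta> \<le> trace R}"
  have "?U \<inter> ?T \<subseteq> matrix_exp ` ?K"
  proof
    fix Q
    assume Q: "Q \<in> ?U \<inter> ?T"
    then obtain \<epsilon> m H where e: "0 \<le> \<epsilon>" "\<epsilon> < 1" and H: "stochastic_matrix (H :: real ^ 'n ^ 'n)"
      and "Q = (1 - \<epsilon>) ^ m *\<^sub>R matrix_power (matrix_inv (mat 1 - \<epsilon> *\<^sub>R H)) m"
      by auto
    then have eq: "Q = matrix_exp (real m *\<^sub>R of_sqmat (resolvent_generator H \<epsilon>))" (is "_ = matrix_exp ?R")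
      by (simp add: exp_resolvent_generator)
    have "\<delta> < exp (trace ?R)"
      using Q by (simp add: eq det_matrix_exp)
    then have "ln \<delta> \<le> trace ?R"
      using d by (metis exp_gt_zero less_imp_le ln_exp ln_less_cancel_iff)
    moreover have "intensity_matrix ?R"
      by (intro intensity_scaleR intensity_resolvent_generator H e) simp
    ultimately show "Q \<in> matrix_exp ` ?K"
      unfolding eq by blast
  qed
  moreover have "closed (matrix_exp ` ?K)"
    by (intro compact_imp_closed compact_continuous_image compact_intensity_trace_ge
        continuous_on_subset[OF continuous_matrix_exp]) auto
  ultimately have "closure (?U \<inter> ?T) \<subseteq> matrix_exp ` ?K"
    by (rule closure_minimal)
  moreover have "open ?U"
    unfolding det_def by (intro open_Collect_less continuous_intros)
  then have "P \<in> closure (?U \<inter> ?T)"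
    using open_Int_closure_subset[of ?U ?T] P(2) d by blast
  ultimately show "embeddable P"
    by (auto simp: embeddable_def)
qed

end
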